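(* For every odd prime $p>2$, \[ \sum_{n=0}^{p-1}\frac{(\frac{1}{2})_n(\frac{1}{3})_n(\frac{2}{3})_n}{(1)_n^3}\left(11n+3\right)\left(\frac{27}{16}\right)^n\equiv 3p \pmod{p^3}. \] Equivalently, $\sum_{n=0}^{p-1}\frac{11n+3}{64^n}\binom{2n}{n}^2\binom{3n}{n}\equiv 3p \pmod{p^3}$.
   Context: $(a)_n=\prod_{k=0}^{n-1}(a+k)$ denotes the Pochhammer symbol (rising factorial), with $(a)_0=1$. Congruences between rational numbers whose denominators are coprime to $p$ are understood in the ring of $p$-integral rationals. *)

theory Defs
  imports Complex_Main "HOL-Computational_Algebra.Primes"
begin

definition rat_cong_ppow :: "rat \<Rightarrow> rat \<Rightarrow> int \<Rightarrow> nat \<Rightarrow> bool" where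
  "rat_cong_ppow x y p k \<longleftrightarrow>
     (\<exists>a b :: int. b \<noteq> 0 \<and> coprime b p \<and> p ^ k dvd a \<and> x - y = of_int a / of_int b)"

end

theory Submission
  imports Defs
begin

text \<open>
  The summand is \<open>F(n,0)\<close> for a Wilf--Zeilberger pair \<open>F(n,k+1) - F(n,k) = G(n+1,k) - G(n,k)\<close> in which
  \<open>F(n,k)\<close> vanishes for \<open>n < 2k\<close>. With \<open>p = 2m + 1\<close>, summing over \<open>n < p\<close> and telescoping in \<open>k\<close> turns the sum
  into \<open>-(G(p,0) + \<dots> + G(p,m))\<close>. For \<open>k < m\<close> the term \<open>G(p,k)\<close> carries an explicit factor \<open>p\<^sup>2\<close>, and a
  further \<open>p\<close> from the factor \<open>1/2 + m = p/2\<close> of a Pochhammer symbol. The last term is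
  \<open>G(p,m) = -8 p (-1)\<^sup>m C(3p,p) C(3p-1,p+m) / 4\<^bsup>3p-1\<^esup>\<close>, so it remains to evaluate two binomial
  coefficients modulo \<open>p\<^sup>2\<close>: with \<open>h = 1 + 1/2 + \<dots> + 1/m\<close> one has \<open>C(3p,p) \<equiv> 3\<close>,
  \<open>(-1)\<^sup>m C(3p-1,p+m) \<equiv> 2 (1 - 3ph)\<close> and \<open>4\<^bsup>p-1\<^esup> \<equiv> 1 - ph\<close>.
\<close>

section \<open>The Wilf--Zeilberger pair\<close>

text \<open>The case \<open>n < 2k\<close> is the convention \<open>1 / (n - 2k)! = 0\<close>.\<close>

definition wz_kernel :: "nat \<Rightarrow> nat \<Rightarrow> rat" where
  "wz_kernel n k = (if n < 2 * k then 0 else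
     (-1) ^ k * pochhammer (1/2) (n - k) * pochhammer (1/2) (n + k) * fact (3 * n)
       / (pochhammer (1/2) k * 4 ^ (n + k) * fact (n + k) * fact (2 * n + 1) * fact (n - 2 * k) * fact n))"

definition wz_F :: "nat \<Rightarrow> nat \<Rightarrow> rat" where
  "wz_F n k = ((2 * of_nat n + 1) * (11 * of_nat n + 3) + 2 * of_nat k * (5 * of_nat n + 1)) * wz_kernel n k"

text \<open>The rational factor in front of the kernel plays the role of the WZ certificate. Its
  factor \<open>n - 2k\<close> makes \<open>G\<close> vanish at \<open>n = 2k\<close>, which removes
  the lower boundary term when telescoping in \<open>n\<close>. Its denominator is a product of two
  odd integers, hence never zero.\<close>

definition wz_G :: "nat \<Rightarrow> nat \<Rightarrow> rat" where
  "wz_G n k = - 16 * of_nat n ^ 2 * (2 * of_nat n + 1) * (of_nat n - 2 * of_nat k)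
     / ((2 * of_nat k + 1) * (2 * of_nat n - 2 * of_nat k - 1)) * wz_kernel n k"

section \<open>Shift ratios of the kernel and the WZ identity\<close>

lemma pochhammer_half_nonzero: "pochhammer (1/2 :: rat) n \<noteq> 0"
  by (metis pochhammer_pos less_irrefl zero_less_divide_1_iff zero_less_numeral)

lemma odd_diff_nonzero: "2 * of_nat n - 2 * of_nat k - 1 \<noteq> (0 :: rat)"
proof
  assume "2 * of_nat n - 2 * of_nat k - 1 = (0 :: rat)"
  then have "of_int (2 * int n - 2 * int k - 1) = (0 :: rat)" by simp
  then have "2 * int n - 2 * int k - 1 = 0" by (simp only: of_int_eq_0_iff)
  then show False by presburger
qed

lemma wz_kernel_Suc_right:
  assumes "2 * k \<le> n"
  shows "wz_kernel n (Suc k) = - ((2 * of_nat n + 2 * of_nat k + 1) * (of_nat n - 2 * of_nat k) * (of_nat n - 2 * of_nat k - 1))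
     / (2 * (2 * of_nat n - 2 * of_nat k - 1) * (2 * of_nat k + 1) * (of_nat n + of_nat k + 1)) * wz_kernel n k"
proof (cases "n < 2 * Suc k")
  case True
  \<comment> \<open>At these two values the left side is 0 by the convention for the kernel, and the
    right side is 0 through the factors \<open>n - 2k\<close> and \<open>n - 2k - 1\<close>. The
    ratio formula thus also holds at the edge of the support.\<close>
  then have "n = 2 * k \<or> n = 2 * k + 1" using assms by auto
  then show ?thesis using True by (auto simp: wz_kernel_def)
next
  case False
  then obtain j where n: "n = 2 * k + j + 2" by (metis add.commute le_Suc_ex mult_Suc_right not_less add.assoc)
  have e: "n - k = Suc (k + j + 1)" "n - Suc k = k + j + 1" "n + Suc k = Suc (n + k)"
     "n - 2 * k = Suc (Suc j)" "n - 2 * Suc k = j" by (auto simp: n)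
  have nz: "2 * of_nat n - 2 * of_nat k - 1 \<noteq> (0::rat)" by (rule odd_diff_nonzero)
  have nz2: "1 + of_nat n + of_nat k \<noteq> (0::rat)" "1 + of_nat k * 2 \<noteq> (0::rat)"
    by (metis of_nat_Suc of_nat_add of_nat_eq_0_iff add_Suc nat.distinct(1),
        metis of_nat_Suc of_nat_mult of_nat_numeral of_nat_eq_0_iff nat.distinct(1) )
  define P where "P = pochhammer (1/2 :: rat) (k + j + 1)"
  define R where "R = pochhammer (1/2 :: rat) (n + k)"
  define S where "S = pochhammer (1/2 :: rat) k"
  have "P \<noteq> 0" "R \<noteq> 0" "S \<noteq> 0" by (simp_all add: P_def R_def S_def pochhammer_half_nonzero)
  have a: "pochhammer (1/2 :: rat) (n - k) = P * (2 * of_nat n - 2 * of_nat k - 1) / 2"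
    unfolding e pochhammer_Suc P_def by (simp add: n field_simps)
  have b: "pochhammer (1/2 :: rat) (n + Suc k) = R * (2 * of_nat n + 2 * of_nat k + 1) / 2"
    unfolding e pochhammer_Suc R_def by (simp add: field_simps)
  have c: "pochhammer (1/2 :: rat) (Suc k) = S * (2 * of_nat k + 1) / 2"
    unfolding e pochhammer_Suc S_def by (simp add: field_simps)
  have f: "fact (n - 2 * k) = ((of_nat n - 2 * of_nat k) * (of_nat n - 2 * of_nat k - 1) * fact j :: rat)"
    unfolding e by (simp add: n algebra_simps)
  have g: "fact (n + Suc k) = ((of_nat n + of_nat k + 1) * fact (n + k) :: rat)"
    unfolding e by (simp add: algebra_simps)
  have "of_nat n - 2 * of_nat k = (of_nat (Suc (Suc j)) :: rat)" "of_nat n - 2 * of_nat k - 1 = (of_nat (Suc j) :: rat)"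
    by (simp_all add: n)
  then have j: "of_nat n - 2 * of_nat k \<noteq> (0::rat)" "of_nat n - 2 * of_nat k - 1 \<noteq> (0::rat)"
    by (simp_all only: of_nat_eq_0_iff)
  have "\<not> n < 2 * k" using assms by simp
  then show ?thesis
    unfolding wz_kernel_def if_not_P[OF False] if_not_P[OF \<open>\<not> n < 2 * k\<close>] a b c f g e(2,5)
      R_def[symmetric] S_def[symmetric] P_def[symmetric]
    using nz nz2 j \<open>P \<noteq> 0\<close> \<open>S \<noteq> 0\<close> 
    by (simp add: divide_simps)
qed

text \<open>The factor \<open>n + 1 - 2k\<close> comes from \<open>(n + 1 - 2k)!\<close> and stays
  on the left because \<open>wz_G (Suc n) k\<close> contains exactly this factor.\<close>

lemma wz_kernel_Suc_left:
  assumes "2 * k \<le> n"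
  shows "(of_nat n + 1 - 2 * of_nat k) * wz_kernel (Suc n) k =
     3 * (2 * of_nat n - 2 * of_nat k + 1) * (2 * of_nat n + 2 * of_nat k + 1) * (3 * of_nat n + 1) * (3 * of_nat n + 2)
     / (32 * (of_nat n + of_nat k + 1) * (of_nat n + 1) * (2 * of_nat n + 3)) * wz_kernel n k"
proof -
  obtain j where n: "n = 2 * k + j" using assms by (metis le_Suc_ex)
  have e: "Suc n - k = Suc (n - k)" "Suc n + k = Suc (n + k)" "Suc n - 2 * k = Suc (n - 2 * k)"
     "3 * Suc n = Suc (Suc (Suc (3 * n)))" "2 * Suc n + 1 = Suc (Suc (2 * n + 1))" using assms by auto
  define P where "P = pochhammer (1/2 :: rat) (n - k)"
  define R where "R = pochhammer (1/2 :: rat) (n + k)"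
  define S where "S = pochhammer (1/2 :: rat) k"
  have "S \<noteq> 0" by (simp add: S_def pochhammer_half_nonzero)
  have a: "pochhammer (1/2 :: rat) (Suc n - k) = P * (2 * of_nat n - 2 * of_nat k + 1) / 2"
    unfolding e pochhammer_Suc P_def by (simp add: n field_simps)
  have b: "pochhammer (1/2 :: rat) (Suc n + k) = R * (2 * of_nat n + 2 * of_nat k + 1) / 2"
    unfolding e pochhammer_Suc R_def by (simp add: field_simps)
  have c: "fact (Suc n - 2 * k) = ((of_nat n + 1 - 2 * of_nat k) * fact (n - 2 * k) :: rat)"
    unfolding e by (simp add: n algebra_simps)
  have d: "fact (Suc n + k) = ((of_nat n + of_nat k + 1) * fact (n + k) :: rat)"
    unfolding e by (simp add: algebra_simps)
  have f: "fact (3 * Suc n) = ((3 * of_nat n + 1) * (3 * of_nat n + 2) * (3 * (of_nat n + 1)) * fact (3 * n) :: rat)"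
    unfolding e by (simp add: algebra_simps)
  have g: "fact (2 * Suc n + 1) = ((2 * (of_nat n + 1)) * (2 * of_nat n + 3) * fact (2 * n + 1) :: rat)"
    unfolding e by (simp add: algebra_simps)
  have h: "fact (Suc n) = ((of_nat n + 1) * fact n :: rat)" by (simp add: algebra_simps)
  have i: "4 ^ (Suc n + k) = (4 * 4 ^ (n + k) :: rat)" by simp
  have "of_nat n + 1 - 2 * of_nat k = (of_nat (Suc j) :: rat)" "of_nat n + of_nat k + 1 = (of_nat (Suc (n + k)) :: rat)"
     "of_nat n + 1 = (of_nat (Suc n) :: rat)" "2 * of_nat n + 3 = (of_nat (2 * n + 3) :: rat)"
    by (simp_all add: n)
  then have nz: "of_nat n + 1 - 2 * of_nat k \<noteq> (0::rat)" "of_nat n + of_nat k + 1 \<noteq> (0::rat)" "of_nat n + 1 \<noteq> (0::rat)"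
      "2 * of_nat n + 3 \<noteq> (0 :: rat)"
    by (simp_all only: of_nat_eq_0_iff)
  have "\<not> n < 2 * k" "\<not> Suc n < 2 * k" using assms by simp_all
  then show ?thesis
    unfolding wz_kernel_def if_not_P[OF \<open>\<not> n < 2 * k\<close>] if_not_P[OF \<open>\<not> Suc n < 2 * k\<close>] a b c d f g h i
      R_def[symmetric] S_def[symmetric] P_def[symmetric]
    using nz \<open>S \<noteq> 0\<close>
    by (simp add: divide_simps) (simp add: algebra_simps)
qed

text \<open>By the two shift ratios all four terms are rational multiples of
  \<open>wz_kernel n k\<close>. Clearing denominators leaves a polynomial identity in
  \<open>n\<close> and \<open>k\<close>.\<close>

lemma wz_pair:
  assumes "2 * k \<le> n"
  shows "wz_F n (Suc k) - wz_F n k = wz_G (Suc n) k - wz_G n k"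
proof -
  define x where "x = (of_nat n :: rat)"
  define y where "y = (of_nat k :: rat)"
  define H where "H = wz_kernel n k"
  have nz: "2 * x - 2 * y - 1 \<noteq> 0" unfolding x_def y_def by (rule odd_diff_nonzero)
  have nz1: "2 * x - 2 * y + 1 \<noteq> 0" using odd_diff_nonzero[of k n] unfolding x_def y_def by linarith
  have "x \<ge> 0" "y \<ge> 0" by (auto simp: x_def y_def)
  then have nz2: "2 * y + 1 \<noteq> 0" "x + y + 1 \<noteq> 0" "x + 1 \<noteq> 0" "2 * x + 3 \<noteq> 0" by linarith+
  have 1: "wz_F n (Suc k) = ((2 * x + 1) * (11 * x + 3) + 2 * (y + 1) * (5 * x + 1)) *
     (- ((2 * x + 2 * y + 1) * (x - 2 * y) * (x - 2 * y - 1)) / (2 * (2 * x - 2 * y - 1) * (2 * y + 1) * (x + y + 1)) * H)"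
    unfolding wz_F_def wz_kernel_Suc_right[OF assms] x_def y_def H_def by (simp add: add.commute)
  have 2: "wz_F n k = ((2 * x + 1) * (11 * x + 3) + 2 * y * (5 * x + 1)) * H"
    by (simp add: wz_F_def x_def y_def H_def)
  have 3: "wz_G n k = - 16 * x ^ 2 * (2 * x + 1) * (x - 2 * y) / ((2 * y + 1) * (2 * x - 2 * y - 1)) * H"
    by (simp add: wz_G_def x_def y_def H_def)
  have "wz_G (Suc n) k = - 16 * (x + 1) ^ 2 * (2 * x + 3) / ((2 * y + 1) * (2 * x - 2 * y + 1)) * ((x + 1 - 2 * y) * wz_kernel (Suc n) k)"
    by (simp add: wz_G_def x_def y_def algebra_simps)
  also have "\<dots> = - 16 * (x + 1) ^ 2 * (2 * x + 3) / ((2 * y + 1) * (2 * x - 2 * y + 1)) *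
    (3 * (2 * x - 2 * y + 1) * (2 * x + 2 * y + 1) * (3 * x + 1) * (3 * x + 2) / (32 * (x + y + 1) * (x + 1) * (2 * x + 3)) * H)"
    unfolding x_def y_def H_def wz_kernel_Suc_left[OF assms] ..
  \<comment> \<open>The factors \<open>2x - 2y + 1\<close>, \<open>2x + 3\<close> and one
    \<open>x + 1\<close> cancel; the remaining denominators already occur in
    \<open>wz_F n (Suc k)\<close>.\<close>
  also have "\<dots> = - (3 * (x + 1) * (2 * x + 2 * y + 1) * (3 * x + 1) * (3 * x + 2)) / (2 * (2 * y + 1) * (x + y + 1)) * H"
    using nz1 nz2 by (simp add: divide_simps power2_eq_square) (simp add: algebra_simps)
  finally have 4: "wz_G (Suc n) k = - (3 * (x + 1) * (2 * x + 2 * y + 1) * (3 * x + 1) * (3 * x + 2)) / (2 * (2 * y + 1) * (x + y + 1)) * H" .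
  show ?thesis unfolding 1 2 3 4 using nz nz2 by (simp add: divide_simps) algebra
qed

section \<open>The summand as \<open>F(n,0)\<close>, and telescoping in \<open>n\<close> and
  \<open>k\<close>\<close>

lemma fact_triple: "fact (3 * n) = (27 ^ n * fact n * pochhammer (1/3) n * pochhammer (2/3) n :: rat)"
proof (induction n)
  case (Suc n)
  have "fact (3 * Suc n) = (of_nat (3 * n + 3) * of_nat (3 * n + 2) * of_nat (3 * n + 1) * fact (3 * n) :: rat)"
    by (simp add: algebra_simps numeral_3_eq_3)
  also have "\<dots> = 27 ^ Suc n * fact (Suc n) * pochhammer (1/3) (Suc n) * pochhammer (2/3) (Suc n)"
    unfolding Suc.IH pochhammer_Suc by (simp add: algebra_simps)
  finally show ?case .
qed simp

lemma fact_double_half: "fact (2 * n) = (4 ^ n * pochhammer (1/2) n * fact n :: rat)"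
proof -
  have "(2 :: rat) ^ (2 * n) = 4 ^ n" by (simp add: power_mult)
  then show ?thesis using fact_double[of n, where 'a = rat] by (simp only:)
qed

text \<open>At \<open>k = 0\<close> the factor \<open>2n + 1\<close> of \<open>wz_F\<close> cancels
  the one in \<open>(2n + 1)!\<close>. The powers \<open>27^n\<close> from \<open>(3n)!\<close> and
  \<open>4^n\<close> from both the kernel and \<open>(2n)!\<close> combine to
  \<open>(27/16)^n\<close>.\<close>

lemma wz_F_zero_right:
  "wz_F n 0 = pochhammer (1/2) n * pochhammer (1/3) n * pochhammer (2/3) n / pochhammer 1 n ^ 3
     * (11 * of_nat n + 3) * (27/16) ^ n"
proof -
  have "2 * of_nat n + 1 = (of_nat (2 * n + 1) :: rat)" by simp
  then have nz: "2 * of_nat n + 1 \<noteq> (0 :: rat)" by (simp only: of_nat_eq_0_iff)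
  have d: "fact (2 * n + 1) = ((2 * of_nat n + 1) * (4 ^ n * pochhammer (1/2) n * fact n) :: rat)"
    using fact_double_half[of n] by simp
  show ?thesis
    unfolding wz_F_def wz_kernel_def d fact_triple
    using nz pochhammer_half_nonzero[of n]
    by (simp add: divide_simps pochhammer_fact[symmetric] power2_eq_square power3_eq_cube flip: power_mult_distrib)
qed

lemma wz_sum_step:
  assumes "2 * k \<le> N"
  shows "(\<Sum>n<N. wz_F n (Suc k)) - (\<Sum>n<N. wz_F n k) = wz_G N k"
proof -
  have "(\<Sum>n<N. wz_F n (Suc k)) - (\<Sum>n<N. wz_F n k) = (\<Sum>n<N. wz_F n (Suc k) - wz_F n k)"
    by (simp add: sum_subtractf)
  \<comment> \<open>For \<open>n < 2k\<close> both \<open>F(n,k)\<close> and \<open>F(n,k+1)\<close>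
    are 0, so the WZ identity is only applied where its hypothesis holds.\<close>
  also have "\<dots> = (\<Sum>n=2*k..<N. wz_F n (Suc k) - wz_F n k)"
    by (rule sum.mono_neutral_right) (auto simp: wz_F_def wz_kernel_def)
  also have "\<dots> = (\<Sum>n=2*k..<N. wz_G (Suc n) k - wz_G n k)"
    by (intro sum.cong) (auto simp: wz_pair)
  also have "\<dots> = wz_G N k - wz_G (2 * k) k" using assms by (rule sum_Suc_diff')
  also have "wz_G (2 * k) k = 0" by (simp add: wz_G_def)
  finally show ?thesis by simp
qed

lemma wz_sum:
  assumes "N = 2 * m + 1"
  shows "(\<Sum>n<N. wz_F n 0) = - (\<Sum>k\<le>m. wz_G N k)"
proof -
  have "(\<Sum>k\<le>m. wz_G N k) = (\<Sum>k\<le>m. (\<Sum>n<N. wz_F n (Suc k)) - (\<Sum>n<N. wz_F n k))"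
    using assms by (intro sum.cong refl wz_sum_step[symmetric]) auto
  also have "\<dots> = (\<Sum>n<N. wz_F n (Suc m)) - (\<Sum>n<N. wz_F n 0)"
    using sum_Suc_diff'[of 0 "Suc m" "\<lambda>k. \<Sum>n<N. wz_F n k"]
    by (simp add: atLeast0LessThan lessThan_Suc_atMost)
  \<comment> \<open>Every \<open>n < N = 2m + 1\<close> lies below \<open>2(m + 1)\<close>, hence
    outside the support.\<close>
  also have "(\<Sum>n<N. wz_F n (Suc m)) = 0"
    using assms by (intro sum.neutral) (auto simp: wz_F_def wz_kernel_def)
  finally show ?thesis by simp
qed

section \<open>The terms of the telescoped sum through binomial coefficients\<close>

lemma pochhammer_half_over_fact:
  "pochhammer (1/2 :: rat) n / fact n = of_nat (2 * n choose n) / 4 ^ n"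
  using fact_double_half[of n] binomial_fact[of n "2 * n", where 'a = rat] by simp

text \<open>For \<open>n = p\<close> the factorials \<open>n!\<close>, \<open>(n+k)!\<close> and
  \<open>(2n)!\<close> are divisible by \<open>p\<close>; here they are absorbed into integer
  binomial coefficients. The factors \<open>2n - 2k - 1\<close>, \<open>n - 2k\<close> and
  \<open>2n + 1\<close> cancel against the last factors of \<open>pochhammer (1/2) (n - k)\<close>,
  \<open>(n - 2k)!\<close> and \<open>(2n + 1)!\<close>.\<close>

lemma wz_G_eq:
  assumes "2 * k < n"
  shows "wz_G n k = - 8 * of_nat n ^ 2 * (-1) ^ k * pochhammer (1/2) (n - k - 1) / pochhammer (1/2) k
     * of_nat (3 * n choose n) * (of_nat (2 * (n + k) choose (n + k)) / 16 ^ (n + k))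
     / ((2 * of_nat k + 1) * fact (n - 2 * k - 1))"
proof -
  obtain j where n: "n = 2 * k + Suc j" using assms less_imp_Suc_add by fastforce
  have e: "n - k = Suc (n - k - 1)" "n - 2 * k = Suc (n - 2 * k - 1)" using assms by auto
  define P where "P = pochhammer (1/2 :: rat) (n - k - 1)"
  define S where "S = pochhammer (1/2 :: rat) k"
  define f where "f = (fact (n - 2 * k - 1) :: rat)"
  have "S \<noteq> 0" "f \<noteq> 0" by (simp_all add: S_def f_def pochhammer_half_nonzero)
  have a: "pochhammer (1/2 :: rat) (n - k) = P * (2 * of_nat n - 2 * of_nat k - 1) / 2"
    by (subst e, subst pochhammer_Suc) (simp add: P_def n field_simps)
  have b: "fact (n - 2 * k) = ((of_nat n - 2 * of_nat k) * f :: rat)"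
    by (subst e, subst fact_Suc) (simp add: f_def n algebra_simps)
  have c: "pochhammer (1/2 :: rat) (n + k) = fact (n + k) * of_nat (2 * (n + k) choose (n + k)) / 4 ^ (n + k)"
    using pochhammer_half_over_fact[of "n + k"] by (simp add: field_simps)
  have d: "fact (3 * n) = (fact n * fact (2 * n) * of_nat (3 * n choose n) :: rat)"
    by (simp add: binomial_fact)
  have g: "fact (2 * n + 1) = ((2 * of_nat n + 1) * fact (2 * n) :: rat)" by (simp add: algebra_simps)
  have h: "(16 :: rat) ^ (n + k) = 4 ^ (n + k) * 4 ^ (n + k)" by (simp flip: power_mult_distrib)
  have "of_nat n - 2 * of_nat k = (of_nat (Suc j) :: rat)" "2 * of_nat n + 1 = (of_nat (2 * n + 1) :: rat)"
     "2 * of_nat k + 1 = (of_nat (2 * k + 1) :: rat)"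
    by (simp_all add: n)
  then have nz: "of_nat n - 2 * of_nat k \<noteq> (0::rat)" "2 * of_nat n + 1 \<noteq> (0::rat)" "2 * of_nat k + 1 \<noteq> (0::rat)"
    by (simp_all only: of_nat_eq_0_iff)
  have "\<not> n < 2 * k" using assms by simp
  show ?thesis
    unfolding wz_G_def wz_kernel_def if_not_P[OF \<open>\<not> n < 2 * k\<close>] a b c d g h
       f_def[symmetric] S_def[symmetric] P_def[symmetric]
    using nz odd_diff_nonzero[of n k] \<open>S \<noteq> 0\<close> \<open>f \<noteq> 0\<close>
    by (simp add: divide_simps)
qed

section \<open>Congruences between p-integral rationals\<close>

text \<open>For prime \<open>p\<close> this is the localization of the integers at \<open>p\<close>,
  taken as a subset of \<open>rat\<close> so that the field operations stay available.\<close>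

definition p_integral :: "nat \<Rightarrow> rat set" where
  "p_integral p = {x. \<exists>a b :: int. b \<noteq> 0 \<and> coprime b (int p) \<and> x = of_int a / of_int b}"

lemma p_integralI: "b \<noteq> 0 \<Longrightarrow> coprime b (int p) \<Longrightarrow> x = of_int a / of_int b \<Longrightarrow> x \<in> p_integral p"
  by (auto simp: p_integral_def)

lemma p_integral_of_int [simp, intro]: "of_int a \<in> p_integral p"
  by (rule p_integralI[of 1]) auto

lemma p_integral_of_nat [simp, intro]: "of_nat a \<in> p_integral p"
  using p_integral_of_int[of "int a"] by simp

lemma p_integral_numeral [simp, intro]: "numeral a \<in> p_integral p"
  using p_integral_of_nat[of "numeral a"] by simp

lemma p_integral_0_1 [simp, intro]: "0 \<in> p_integral p" "1 \<in> p_integral p"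
  using p_integral_of_nat[of 0] p_integral_of_nat[of 1] by simp_all

lemma p_integral_add [intro]:
  assumes "x \<in> p_integral p" "y \<in> p_integral p"
  shows "x + y \<in> p_integral p"
proof -
  obtain a b c d :: int where "b \<noteq> 0" "coprime b (int p)" "x = of_int a / of_int b"
    "d \<noteq> 0" "coprime d (int p)" "y = of_int c / of_int d"
    using assms by (auto simp: p_integral_def)
  then show ?thesis
    by (intro p_integralI[of "b * d" _ _ "a * d + c * b"]) (auto simp: field_simps)
qed

lemma p_integral_mult [intro]:
  assumes "x \<in> p_integral p" "y \<in> p_integral p"
  shows "x * y \<in> p_integral p"
proof -
  obtain a b c d :: int where "b \<noteq> 0" "coprime b (int p)" "x = of_int a / of_int b"
    "d \<noteq> 0" "coprime d (int p)" "y = of_int c / of_int d"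
    using assms by (auto simp: p_integral_def)
  then show ?thesis
    by (intro p_integralI[of "b * d" _ _ "a * c"]) auto
qed

lemma p_integral_uminus [intro]: "x \<in> p_integral p \<Longrightarrow> - x \<in> p_integral p"
  using p_integral_mult[OF p_integral_of_int[of "- 1"]] by fastforce

lemma p_integral_diff [intro]: "x \<in> p_integral p \<Longrightarrow> y \<in> p_integral p \<Longrightarrow> x - y \<in> p_integral p"
  using p_integral_add[OF _ p_integral_uminus, of x p y] by simp

lemma p_integral_sum [intro]: "(\<And>i. i \<in> A \<Longrightarrow> f i \<in> p_integral p) \<Longrightarrow> sum f A \<in> p_integral p"
  by (induction A rule: infinite_finite_induct) auto

lemma p_integral_prod [intro]: "(\<And>i. i \<in> A \<Longrightarrow> f i \<in> p_integral p) \<Longrightarrow> prod f A \<in> p_integral p"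
  by (induction A rule: infinite_finite_induct) auto

lemma p_integral_power [intro]: "x \<in> p_integral p \<Longrightarrow> x ^ n \<in> p_integral p"
  by (induction n) auto

lemma p_integral_pochhammer [intro]: "x \<in> p_integral p \<Longrightarrow> pochhammer x n \<in> p_integral p"
  unfolding pochhammer_prod by auto

lemma p_integral_divide:
  assumes "x \<in> p_integral p" "coprime b p" "b \<noteq> 0"
  shows "x / of_nat b \<in> p_integral p"
proof -
  have "1 / of_nat b \<in> p_integral p"
    using assms by (intro p_integralI[of "int b" _ _ 1]) auto
  then show ?thesis using p_integral_mult[OF assms(1)] by fastforce
qed

text \<open>With the quotient of \<open>x - y\<close> by \<open>p ^ k\<close> named explicitly, each
  congruence rule below amounts to exhibiting a quotient and using closure of
  \<open>p_integral\<close>.\<close>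

lemma rat_cong_ppow_iff:
  "rat_cong_ppow x y (int p) k \<longleftrightarrow> (\<exists>z\<in>p_integral p. x = y + of_nat p ^ k * z)"
proof
  assume "rat_cong_ppow x y (int p) k"
  then obtain a b c :: int where "b \<noteq> 0" "coprime b (int p)" "a = int p ^ k * c" "x - y = of_int a / of_int b"
    unfolding rat_cong_ppow_def dvd_def by blast
  then show "\<exists>z\<in>p_integral p. x = y + of_nat p ^ k * z"
    by (intro bexI[of _ "of_int c / of_int b"] p_integralI[of b]) (auto simp: field_simps)
next
  assume "\<exists>z\<in>p_integral p. x = y + of_nat p ^ k * z"
  then obtain a b :: int where "b \<noteq> 0" "coprime b (int p)" "x = y + of_nat p ^ k * (of_int a / of_int b)"
    unfolding p_integral_def by blast
  then show "rat_cong_ppow x y (int p) k" unfolding rat_cong_ppow_def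
    by (intro exI[of _ "int p ^ k * a"] exI[of _ b]) auto
qed

lemma rat_cong_ppow_refl [simp]: "rat_cong_ppow x x (int p) k"
  unfolding rat_cong_ppow_iff by (intro bexI[of _ 0]) auto

lemma rat_cong_ppow_trans [trans]:
  assumes "rat_cong_ppow x y (int p) k" "rat_cong_ppow y w (int p) k"
  shows "rat_cong_ppow x w (int p) k"
proof -
  obtain z z' where "z \<in> p_integral p" "x = y + of_nat p ^ k * z" "z' \<in> p_integral p" "y = w + of_nat p ^ k * z'"
    using assms unfolding rat_cong_ppow_iff by blast
  then show ?thesis unfolding rat_cong_ppow_iff by (intro bexI[of _ "z + z'"]) (auto simp: algebra_simps)
qed

lemma rat_cong_ppow_sym:
  "rat_cong_ppow x y (int p) k \<Longrightarrow> rat_cong_ppow y x (int p) k"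
proof -
  assume "rat_cong_ppow x y (int p) k"
  then obtain z where "z \<in> p_integral p" "x = y + of_nat p ^ k * z" unfolding rat_cong_ppow_iff by blast
  then show ?thesis unfolding rat_cong_ppow_iff by (intro bexI[of _ "-z"]) auto
qed

lemma rat_cong_ppow_add:
  assumes "rat_cong_ppow x y (int p) k" "rat_cong_ppow x' y' (int p) k"
  shows "rat_cong_ppow (x + x') (y + y') (int p) k"
proof -
  obtain z z' where "z \<in> p_integral p" "x = y + of_nat p ^ k * z" "z' \<in> p_integral p" "x' = y' + of_nat p ^ k * z'"
    using assms unfolding rat_cong_ppow_iff by blast
  then show ?thesis unfolding rat_cong_ppow_iff by (intro bexI[of _ "z + z'"]) (auto simp: algebra_simps)
qed

lemma rat_cong_ppow_sum:
  "(\<And>i. i \<in> A \<Longrightarrow> rat_cong_ppow (f i) (g i) (int p) k) \<Longrightarrow> rat_cong_ppow (sum f A) (sum g A) (int p) k"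
  by (induction A rule: infinite_finite_induct) (auto intro!: rat_cong_ppow_add)

lemma rat_cong_ppow_mult_left:
  assumes "rat_cong_ppow x y (int p) k" "c \<in> p_integral p"
  shows "rat_cong_ppow (c * x) (c * y) (int p) k"
proof -
  obtain z where "z \<in> p_integral p" "x = y + of_nat p ^ k * z"
    using assms unfolding rat_cong_ppow_iff by blast
  then show ?thesis using assms unfolding rat_cong_ppow_iff by (intro bexI[of _ "c * z"]) (auto simp: algebra_simps)
qed

text \<open>This lets low-precision facts, such as a harmonic sum modulo \<open>p\<close>, serve
  modulo a higher power once a factor \<open>p\<close> has been split off.\<close>

lemma rat_cong_ppow_mult_ppow:
  assumes "rat_cong_ppow x y (int p) k"
  shows "rat_cong_ppow (of_nat p ^ i * x) (of_nat p ^ i * y) (int p) (i + k)"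
proof -
  obtain z where "z \<in> p_integral p" "x = y + of_nat p ^ k * z"
    using assms unfolding rat_cong_ppow_iff by blast
  then show ?thesis unfolding rat_cong_ppow_iff by (intro bexI[of _ z]) (auto simp: algebra_simps power_add)
qed

lemma rat_cong_ppow_mult:
  assumes "rat_cong_ppow x y (int p) k" "rat_cong_ppow x' y' (int p) k" "y \<in> p_integral p" "y' \<in> p_integral p"
  shows "rat_cong_ppow (x * x') (y * y') (int p) k"
proof -
  obtain z z' where "z \<in> p_integral p" "x = y + of_nat p ^ k * z" "z' \<in> p_integral p" "x' = y' + of_nat p ^ k * z'"
    using assms unfolding rat_cong_ppow_iff by blast
  then show ?thesis using assms(3,4) unfolding rat_cong_ppow_iff
    by (intro bexI[of _ "y * z' + z * y' + of_nat p ^ k * z * z'"] p_integral_add p_integral_mult p_integral_power)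
       (auto simp: algebra_simps)
qed

text \<open>First-order expansion: every cross term carries \<open>p^2\<close>. It turns products of
  ratios into harmonic sums.\<close>

lemma rat_cong_ppow_prod_one_plus:
  assumes "finite A" "\<And>i. i \<in> A \<Longrightarrow> rat_cong_ppow (f i) (1 + of_nat p * g i) (int p) 2"
    and "\<And>i. i \<in> A \<Longrightarrow> g i \<in> p_integral p"
  shows "rat_cong_ppow (prod f A) (1 + of_nat p * sum g A) (int p) 2"
  using assms
proof (induction A rule: finite_induct)
  case (insert a A)
  have g: "g a \<in> p_integral p" "sum g A \<in> p_integral p" using insert.prems by auto
  have "rat_cong_ppow (f a * prod f A) ((1 + of_nat p * g a) * (1 + of_nat p * sum g A)) (int p) 2"
    using insert g by (intro rat_cong_ppow_mult) auto
  also have "rat_cong_ppow ((1 + of_nat p * g a) * (1 + of_nat p * sum g A)) (1 + of_nat p * (g a + sum g A)) (int p) 2"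
    unfolding rat_cong_ppow_iff using g
    by (intro bexI[of _ "g a * sum g A"]) (auto simp: algebra_simps power2_eq_square)
  finally show ?case using insert.hyps by simp
qed simp

section \<open>Harmonic sums and binomial coefficients modulo powers of an odd prime\<close>

text \<open>Reversing the sign of the even-indexed terms subtracts each \<open>1/(2j)\<close> twice,
  that is, \<open>1/j\<close>.\<close>

lemma alternating_harmonic:
  "(\<Sum>j=1..2*n. (-1) ^ (j - 1) / of_nat j) = (\<Sum>j=1..2*n. 1 / of_nat j) - (\<Sum>j=1..n. 1 / of_nat j :: rat)"
proof (induction n)
  case (Suc n)
  have "of_nat (Suc (Suc (2 * n))) = (2 * of_nat (Suc n) :: rat)" by simp
  then have "2 / of_nat (Suc (Suc (2 * n))) = (1 / of_nat (Suc n) :: rat)"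
    by (simp only: divide_simps) simp
  moreover have "2 * Suc n = Suc (Suc (2 * n))" by simp
  ultimately show ?case using Suc.IH by (simp del: of_nat_Suc)
qed simp

lemma binomial_prod: "of_nat (n + r choose r) = (\<Prod>i=1..r. (of_nat n + of_nat i) / of_nat i :: rat)"
proof (induction r)
  case (Suc r)
  have "Suc r * (n + Suc r choose Suc r) = (n + Suc r) * (n + r choose r)"
    using Suc_times_binomial_eq[of "n + r" r] by (simp add: mult.commute)
  then have "of_nat (Suc r) * of_nat (n + Suc r choose Suc r) = (of_nat (n + Suc r) * of_nat (n + r choose r) :: rat)"
    by (metis of_nat_mult)
  then have "of_nat (n + Suc r choose Suc r) = (of_nat (n + r choose r) * ((of_nat n + of_nat (Suc r)) / of_nat (Suc r)) :: rat)"
    by (simp add: field_simps del: binomial_Suc_Suc)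
  then show ?case using Suc by simp
qed simp

locale odd_prime =
  fixes p m :: nat
  assumes prime_p: "prime p" and p_eq: "p = 2 * m + 1"
begin

abbreviation p_cong :: "rat \<Rightarrow> rat \<Rightarrow> nat \<Rightarrow> bool" where
  "p_cong x y k \<equiv> rat_cong_ppow x y (int p) k"

lemma coprime_below: "0 < i \<Longrightarrow> i < p \<Longrightarrow> coprime i p"
  using prime_p by (metis coprime_commute nat_dvd_not_less prime_imp_coprime)

lemma divide_below: "x \<in> p_integral p \<Longrightarrow> 0 < i \<Longrightarrow> i < p \<Longrightarrow> x / of_nat i \<in> p_integral p"
  by (rule p_integral_divide) (auto simp: coprime_below)

lemma m_pos: "m > 0"
  using prime_p p_eq by (metis One_nat_def add.left_neutral gr0I mult_0_right not_prime_1)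

lemma divide_two_power: "x \<in> p_integral p \<Longrightarrow> x / 2 ^ i \<in> p_integral p"
  using p_integral_divide[of x p "2 ^ i"] coprime_below[of 2] m_pos p_eq by simp

text \<open>Pairing \<open>j\<close> with \<open>p - j\<close> gives
  \<open>1/j + 1/(p - j) = p / (j (p - j))\<close>. This computes twice the sum, and 2 is invertible
  modulo \<open>p\<close>.\<close>

lemma harmonic_cong: "p_cong (\<Sum>j=1..<p. 1 / of_nat j) 0 1"
proof -
  let ?H = "\<Sum>j=1..<p. 1 / of_nat j :: rat"
  have "?H = (\<Sum>j=1..<p. 1 / of_nat (p - j))"
    by (subst sum.atLeastLessThan_rev) simp
  then have "2 * ?H = (\<Sum>j=1..<p. 1 / of_nat j + 1 / of_nat (p - j))"
    by (simp add: sum.distrib)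
  also have "\<dots> = (\<Sum>j=1..<p. of_nat p * (1 / of_nat j / of_nat (p - j)))"
    by (intro sum.cong) (auto simp: of_nat_diff field_simps)
  also have "\<dots> = of_nat p * (\<Sum>j=1..<p. 1 / of_nat j / of_nat (p - j))"
    by (simp add: sum_distrib_left)
  finally have "?H = 0 + of_nat p ^ 1 * ((\<Sum>j=1..<p. 1 / of_nat j / of_nat (p - j)) / 2 ^ 1)" by simp
  moreover have "(\<Sum>j=1..<p. 1 / of_nat j / of_nat (p - j)) / 2 ^ 1 \<in> p_integral p"
    by (intro divide_two_power p_integral_sum divide_below) auto
  ultimately show ?thesis unfolding rat_cong_ppow_iff by blast
qed

lemma binomial_p: "0 < j \<Longrightarrow> of_nat (p choose j) = (of_nat p * (of_nat (p - 1 choose (j - 1)) / of_nat j) :: rat)"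
proof -
  assume "0 < j"
  then have "j * (p choose j) = p * (p - 1 choose (j - 1))"
    using Suc_times_binomial_eq[of "p - 1" "j - 1"] p_eq by (simp add: mult.commute)
  then have "of_nat j * of_nat (p choose j) = (of_nat p * of_nat (p - 1 choose (j - 1)) :: rat)"
    by (metis of_nat_mult)
  then show ?thesis using \<open>0 < j\<close> by (simp add: field_simps)
qed

text \<open>By Pascal's rule neighbouring entries of row \<open>p - 1\<close> add up to an entry
  \<open>C(p, j+1)\<close> divisible by \<open>p\<close>, so the entries alternate in sign modulo
  \<open>p\<close>.\<close>

lemma binomial_p_minus_1_cong: "j < p \<Longrightarrow> p_cong (of_nat (p - 1 choose j)) ((-1) ^ j) 1"
proof (induction j)
  case (Suc j)
  have "p choose Suc j = (p - 1 choose j) + (p - 1 choose Suc j)"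
    using p_eq by simp
  then have "of_nat (p - 1 choose Suc j) = (of_nat (p choose Suc j) + (-1) * of_nat (p - 1 choose j) :: rat)"
    by simp
  also have "p_cong \<dots> (0 + (-1) * (-1) ^ j) 1"
  proof (intro rat_cong_ppow_add rat_cong_ppow_mult_left)
    show "p_cong (of_nat (p choose Suc j)) 0 1"
      unfolding rat_cong_ppow_iff using Suc.prems binomial_p[of "Suc j"]
      by (intro bexI[of _ "of_nat (p - 1 choose j) / of_nat (Suc j)"] divide_below) auto
  qed (use Suc in auto)
  finally show ?case by simp
qed simp

text \<open>The \<open>h\<close> of the introduction. By \<open>two_power_cong\<close> it is
  congruent modulo \<open>p\<close> to -2 times the Fermat quotient of 2.\<close>

definition half_harmonic :: rat where "half_harmonic = (\<Sum>j=1..m. 1 / of_nat j)"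

lemma half_harmonic_integral: "half_harmonic \<in> p_integral p"
  unfolding half_harmonic_def using p_eq by (intro p_integral_sum divide_below) auto

text \<open>Expand \<open>2^p\<close> as a row sum. The inner entries are
  \<open>(p/j) C(p-1, j-1)\<close>, congruent to \<open>p (-1)^(j-1) / j\<close> modulo
  \<open>p^2\<close>. The alternating sum equals the full harmonic sum minus \<open>h\<close>, hence
  is \<open>-h\<close> modulo \<open>p\<close>; halving finishes the proof.\<close>

lemma two_power_cong: "p_cong (2 ^ (p - 1)) (1 + of_nat p * (- half_harmonic / 2)) 2"
proof -
  have "(2 :: rat) ^ p = of_nat (\<Sum>j\<le>p. p choose j)" by (simp add: choose_row_sum)
  also have "{..p} = insert 0 (insert p {1..<p})" by auto
  also have "(\<Sum>j\<in>\<dots>. p choose j) = 2 + (\<Sum>j=1..<p. p choose j)" using p_eq by simp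
  also have "of_nat \<dots> = (2 + (\<Sum>j=1..<p. of_nat (p choose j)) :: rat)" by simp
  also have "(\<Sum>j=1..<p. of_nat (p choose j)) = (\<Sum>j=1..<p. (of_nat p * (of_nat (p - 1 choose (j - 1)) / of_nat j) :: rat))"
    by (intro sum.cong binomial_p) auto
  also have "\<dots> = of_nat p ^ 1 * (\<Sum>j=1..<p. 1 / of_nat j * of_nat (p - 1 choose (j - 1)))"
    by (simp add: sum_distrib_left)
  finally have 1: "(2 :: rat) ^ p = 2 + of_nat p ^ 1 * (\<Sum>j=1..<p. 1 / of_nat j * of_nat (p - 1 choose (j - 1)))" .
  have "p_cong (\<Sum>j=1..<p. 1 / of_nat j * of_nat (p - 1 choose (j - 1))) (\<Sum>j=1..<p. 1 / of_nat j * (-1) ^ (j - 1)) 1"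
    by (intro rat_cong_ppow_sum rat_cong_ppow_mult_left binomial_p_minus_1_cong divide_below) auto
  also have "(\<Sum>j=1..<p. 1 / of_nat j * (-1) ^ (j - 1)) = (\<Sum>j=1..<p. 1 / of_nat j) + (- half_harmonic)"
    using alternating_harmonic[of m] by (simp add: half_harmonic_def p_eq atLeastLessThanSuc_atLeastAtMost)
  also have "p_cong \<dots> (0 + (- half_harmonic)) 1" by (intro rat_cong_ppow_add harmonic_cong rat_cong_ppow_refl)
  finally have "p_cong (2 ^ p) (2 + of_nat p ^ 1 * (0 + (- half_harmonic))) (1 + 1)"
    unfolding 1 by (intro rat_cong_ppow_add rat_cong_ppow_mult_ppow rat_cong_ppow_refl)
  then have "p_cong (1 / 2 ^ 1 * 2 ^ p) (1 / 2 ^ 1 * (2 + of_nat p ^ 1 * (0 + (- half_harmonic)))) 2"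
    by (intro rat_cong_ppow_mult_left divide_two_power) (auto simp: numeral_2_eq_2)
  then show ?thesis using p_eq by (simp add: field_simps)
qed

text \<open>Since \<open>2 (3p - 1) = 4 + 6 (p - 1)\<close>, the power is 16 times the sixth power
  of \<open>2^(p-1)\<close>. That sixth power is treated as a constant product to first order,
  giving \<open>6 * (-h/2) = -3h\<close>.\<close>

lemma four_power_cong: "p_cong (4 ^ (3 * p - 1)) (16 * (1 - 3 * of_nat p * half_harmonic)) 2"
proof -
  have "p_cong (\<Prod>i<6::nat. 2 ^ (p - 1)) (1 + of_nat p * (\<Sum>i<6::nat. - half_harmonic / 2)) 2"
    using divide_two_power[OF p_integral_uminus[OF half_harmonic_integral], of 1]
    by (intro rat_cong_ppow_prod_one_plus two_power_cong) auto
  then have "p_cong (16 * (2 ^ (p - 1)) ^ 6) (16 * (1 + of_nat p * (6 * (- half_harmonic / 2)))) 2"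
    by (intro rat_cong_ppow_mult_left) auto
  moreover have "16 * (2 ^ (p - 1)) ^ 6 = (4 ^ (3 * p - 1) :: rat)"
  proof -
    have "16 * (2 ^ (p - 1)) ^ 6 = (2 :: rat) ^ (4 + (p - 1) * 6)" by (simp add: power_add power_mult)
    also have "4 + (p - 1) * 6 = 2 * (3 * p - 1)" using p_eq by simp
    finally show ?thesis by (simp add: power_mult)
  qed
  ultimately show ?thesis by (simp add: algebra_simps)
qed

text \<open>The coefficient is the product of \<open>(2p + i)/i = 1 + 2p/i\<close> over
  \<open>0 < i < p\<close>; its first-order term is \<open>2p\<close> times a harmonic sum divisible
  by \<open>p\<close>.\<close>

lemma binomial_3p_minus_1_cong: "p_cong (of_nat (3 * p - 1 choose (p - 1))) 1 2"
proof -
  have "3 * p - 1 = 2 * p + (p - 1)" using p_eq by simp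
  then have "of_nat (3 * p - 1 choose (p - 1)) = (\<Prod>i=1..p-1. (of_nat (2 * p) + of_nat i) / of_nat i :: rat)"
    using binomial_prod[of "2 * p" "p - 1"] by simp
  also have "{1..p-1} = {1..<p}" using p_eq by auto
  also have "p_cong (\<Prod>i=1..<p. (of_nat (2 * p) + of_nat i) / of_nat i) (1 + of_nat p * (\<Sum>i=1..<p. 2 * (1 / of_nat i))) 2"
  proof (rule rat_cong_ppow_prod_one_plus)
    fix i assume "i \<in> {1..<p}"
    then have "(of_nat (2 * p) + of_nat i) / of_nat i = (1 + of_nat p * (2 * (1 / of_nat i)) :: rat)"
      by (simp add: field_simps)
    then show "p_cong ((of_nat (2 * p) + of_nat i) / of_nat i) (1 + of_nat p * (2 * (1 / of_nat i))) 2" by simp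
  qed (auto intro!: divide_below)
  also have "1 + of_nat p * (\<Sum>i=1..<p. 2 * (1 / of_nat i)) = 1 + of_nat p ^ 1 * (2 * (\<Sum>i=1..<p. 1 / of_nat i) :: rat)"
    by (simp add: sum_distrib_left)
  also have "p_cong \<dots> (1 + of_nat p ^ 1 * (2 * 0)) 2"
    \<comment> \<open>The exponent 2 is split as 1 + 1: one \<open>p\<close> is explicit, the other
      comes from \<open>harmonic_cong\<close>.\<close>
    unfolding one_add_one[symmetric, where 'a = nat]
    by (intro rat_cong_ppow_add rat_cong_ppow_mult_ppow rat_cong_ppow_mult_left harmonic_cong) auto
  finally show ?thesis by simp
qed

lemma binomial_3p_cong: "p_cong (of_nat (3 * p choose p)) 3 2"
proof -
  have e: "Suc (p - 1) = p" "Suc (3 * p - 1) = 3 * p" using p_eq by simp_all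
  have "p * (3 * p choose p) = p * (3 * (3 * p - 1 choose (p - 1)))"
    using Suc_times_binomial_eq[of "3 * p - 1" "p - 1"] unfolding e by (auto simp: ac_simps)
  then have "(3 * p choose p) = 3 * (3 * p - 1 choose (p - 1))"
    using prime_gt_0_nat[OF prime_p] by simp
  then have "of_nat (3 * p choose p) = (3 * of_nat (3 * p - 1 choose (p - 1)) :: rat)" by simp
  also have "p_cong \<dots> (3 * 1) 2"
    by (intro rat_cong_ppow_mult_left binomial_3p_minus_1_cong) auto
  finally show ?thesis by simp
qed

text \<open>The lower index moves up from \<open>p - 1\<close> one step at a time. The step to
  \<open>p\<close> has ratio \<open>2p/p = 2\<close> and is kept apart because its denominator is
  \<open>p\<close>; all later denominators \<open>p + l\<close> are prime to
  \<open>p\<close>.\<close>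

lemma binomial_middle_prod:
  "i < p \<Longrightarrow> of_nat (3 * p - 1 choose (p + i)) =
     (2 * of_nat (3 * p - 1 choose (p - 1)) * (\<Prod>l=1..i. (2 * of_nat p - of_nat l) / (of_nat p + of_nat l)) :: rat)"
proof (induction i)
  case 0
  have e: "Suc (p - 1) = p" "Suc (2 * p - 1) = 2 * p" "Suc (p - 1 + (2 * p - 1)) = 3 * p - 1" using p_eq by simp_all
  have "p * (3 * p - 1 choose p) = p * (2 * (3 * p - 1 choose (p - 1)))"
    using Suc_times_binomial_add[of "p - 1" "2 * p - 1"] unfolding e by (simp add: ac_simps)
  then have "(3 * p - 1 choose p) = 2 * (3 * p - 1 choose (p - 1))" using 0 by simp
  then show ?case by simp
next
  case (Suc i)
  have e: "Suc (p + i + (2 * p - 2 - i)) = 3 * p - 1" "Suc (2 * p - 2 - i) = 2 * p - Suc i" using Suc.prems by auto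
  have "(p + Suc i) * (3 * p - 1 choose (p + Suc i)) = (2 * p - Suc i) * (3 * p - 1 choose (p + i))"
    using Suc_times_binomial_add[of "p + i" "2 * p - 2 - i"] unfolding e by simp
  then have "of_nat (p + Suc i) * of_nat (3 * p - 1 choose (p + Suc i)) = (of_nat (2 * p - Suc i) * of_nat (3 * p - 1 choose (p + i)) :: rat)"
    by (metis of_nat_mult)
  then have "of_nat (3 * p - 1 choose (p + Suc i)) =
      (of_nat (3 * p - 1 choose (p + i)) * (of_nat (2 * p - Suc i) / of_nat (p + Suc i)) :: rat)"
    by (subst times_divide_eq_right, subst nonzero_eq_divide_eq) (simp_all add: mult.commute del: of_nat_Suc)
  moreover have "of_nat (2 * p - Suc i) = (2 * of_nat p - of_nat (Suc i) :: rat)" using Suc.prems by (simp add: of_nat_diff)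
  ultimately have "of_nat (3 * p - 1 choose (p + Suc i)) =
      (of_nat (3 * p - 1 choose (p + i)) * ((2 * of_nat p - of_nat (Suc i)) / (of_nat p + of_nat (Suc i))) :: rat)"
    by (simp only: of_nat_add)
  then show ?case using Suc by (simp del: of_nat_Suc)
qed

text \<open>The sign \<open>(-1)^m\<close> turns the \<open>m\<close> factors \<open>2p - l\<close>
  into \<open>l - 2p\<close>, so that each ratio is congruent to \<open>1 - 3p/l\<close> modulo
  \<open>p^2\<close>.\<close>

lemma binomial_middle_cong:
  "p_cong ((-1) ^ m * of_nat (3 * p - 1 choose (p + m))) (2 * (1 - 3 * of_nat p * half_harmonic)) 2"
proof -
  have "p_cong (\<Prod>l=1..m. (of_nat l - 2 * of_nat p) / (of_nat p + of_nat l)) (1 + of_nat p * (\<Sum>l=1..m. - 3 * (1 / of_nat l))) 2"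
  proof (rule rat_cong_ppow_prod_one_plus)
    fix l assume l: "l \<in> {1..m}"
    have "0 < l" "l < p" using l p_eq by auto
    then have "coprime (p + l) p" using coprime_below[of l] by (metis add.commute coprime_iff_gcd_eq_1 gcd_add1)
    then have "3 * (1 / of_nat l) / of_nat (p + l) \<in> p_integral p"
      using l p_eq by (intro p_integral_divide[of _ _ "p + l"] p_integral_mult divide_below) auto
    \<comment> \<open>The ratio is \<open>1 - 3p/(p + l)\<close>; now use
      \<open>1/(p + l) = 1/l - p/(l (p + l))\<close>.\<close>
    moreover have "(of_nat l - 2 * of_nat p) / (of_nat p + of_nat l) =
        (1 + of_nat p * (- 3 * (1 / of_nat l)) + of_nat p ^ 2 * (3 * (1 / of_nat l) / of_nat (p + l)) :: rat)"
    proof -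
      have "(x - 2 * y) / (y + x) = 1 + y * (- 3 * (1 / x)) + y ^ 2 * (3 * (1 / x) / (y + x))"
        if "x \<noteq> 0" "y + x \<noteq> 0" for x y :: rat
        using that by (simp add: divide_simps) algebra
      moreover have "of_nat l \<noteq> (0 :: rat)" "of_nat p + of_nat l \<noteq> (0::rat)" using l
        by (simp_all flip: of_nat_add)
      ultimately show ?thesis by (simp only: of_nat_add)
    qed
    ultimately show "p_cong ((of_nat l - 2 * of_nat p) / (of_nat p + of_nat l)) (1 + of_nat p * (- 3 * (1 / of_nat l))) 2"
      unfolding rat_cong_ppow_iff by blast
  next
    fix l assume "l \<in> {1..m}"
    then show "- 3 * (1 / of_nat l) \<in> p_integral p"
      using p_eq by (intro p_integral_mult p_integral_uminus divide_below) auto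
  qed auto
  also have "(\<Sum>l=1..m. - 3 * (1 / of_nat l)) = - 3 * half_harmonic"
    by (simp only: half_harmonic_def sum_distrib_left)
  finally have 1: "p_cong (\<Prod>l=1..m. (of_nat l - 2 * of_nat p) / (of_nat p + of_nat l)) (1 + of_nat p * (- 3 * half_harmonic)) 2" .
  have "(\<Prod>l=1..m. (of_nat l - 2 * of_nat p) / (of_nat p + of_nat l) :: rat) =
      (\<Prod>l=1..m. (-1) * ((2 * of_nat p - of_nat l) / (of_nat p + of_nat l)))"
    by (intro prod.cong) (auto simp: minus_divide_left)
  also have "\<dots> = (-1) ^ m * (\<Prod>l=1..m. (2 * of_nat p - of_nat l) / (of_nat p + of_nat l))"
    by (subst prod.distrib) simp
  finally have "(-1) ^ m * of_nat (3 * p - 1 choose (p + m)) = of_nat (3 * p - 1 choose (p - 1)) *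
      (2 * (\<Prod>l=1..m. (of_nat l - 2 * of_nat p) / (of_nat p + of_nat l)) :: rat)"
    using binomial_middle_prod[of m] p_eq by simp
  also have "p_cong \<dots> (1 * (2 * (1 + of_nat p * (- 3 * half_harmonic)))) 2"
    using half_harmonic_integral
    by (intro rat_cong_ppow_mult binomial_3p_minus_1_cong rat_cong_ppow_mult_left 1 p_integral_mult p_integral_add p_integral_uminus) auto
  finally show ?thesis by (simp add: algebra_simps)
qed

section \<open>The boundary terms \<open>G(p,k)\<close> modulo \<open>p^3\<close>\<close>

lemma wz_G_cong_0:
  assumes "k < m"
  shows "p_cong (wz_G p k) 0 3"
proof -
  \<comment> \<open>The number of factors of \<open>pochhammer (1/2) (p - k - 1)\<close> after the
    factor \<open>1/2 + m\<close>; it equals \<open>m - k - 1\<close>.\<close>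
  define r where "r = p - 2 * k - 1 - Suc (m - k)"
  have h: "1/2 \<in> p_integral p" using divide_two_power[of 1 1] by simp
  have "p - k - 1 = k + (m - k + Suc r)" unfolding r_def using assms p_eq by simp
  then have "pochhammer (1/2) (p - k - 1) / pochhammer (1/2) k = (pochhammer (1/2 + of_nat k) (m - k + Suc r) :: rat)"
    by (simp only: pochhammer_product') (simp add: pochhammer_half_nonzero)
  \<comment> \<open>The product is split around its factor \<open>1/2 + m = p/2\<close>, which
    supplies the third power of \<open>p\<close>.\<close>
  also have "\<dots> = pochhammer (1/2 + of_nat k) (m - k) * (1/2 + of_nat k + of_nat (m - k)) * pochhammer (1/2 + of_nat k + of_nat (m - k) + 1) r"
    by (simp only: pochhammer_product' pochhammer_rec mult.assoc)
  also have "1/2 + of_nat k + of_nat (m - k) = (of_nat p * (1/2) :: rat)"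
    using assms by (simp add: p_eq of_nat_diff field_simps)
  finally have 1: "pochhammer (1/2) (p - k - 1) / pochhammer (1/2) k =
    of_nat p * ((1/2) * pochhammer (1/2 + of_nat k) (m - k) * pochhammer (of_nat p * (1/2) + 1) r :: rat)" by simp
  \<comment> \<open>The quotient of \<open>G(p,k)\<close> by \<open>p^3\<close>. It is p-integral
    because \<open>2k + 1 < p\<close> for \<open>k < m\<close>, the factorial has an argument below
    \<open>p\<close>, and 16 is a power of 2.\<close>
  define z :: rat where "z = - 8 * (-1) ^ k * ((1/2) * pochhammer (1/2 + of_nat k) (m - k) * pochhammer (of_nat p * (1/2) + 1) r)
    * of_nat (3 * p choose p) * (of_nat (2 * (p + k) choose (p + k)) / 2 ^ (4 * (p + k))) / of_nat (2 * k + 1) / of_nat (fact (p - 2 * k - 1))"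
  have "coprime (fact (p - 2 * k - 1)) p"
    using prime_p p_eq by (subst coprime_commute, intro prime_imp_coprime) (auto simp: prime_dvd_fact_iff)
  then have z: "z \<in> p_integral p" unfolding z_def using h assms p_eq
    by (intro p_integral_divide[of _ _ "fact _"] divide_below p_integral_mult divide_two_power p_integral_pochhammer
       p_integral_add p_integral_uminus p_integral_power) auto
  have e: "(2 :: rat) ^ (4 * (p + k)) = 16 ^ (p + k)" by (simp only: power_mult) simp
  have "wz_G p k = - 8 * of_nat p ^ 2 * (-1) ^ k * (pochhammer (1/2) (p - k - 1) / pochhammer (1/2) k)
     * of_nat (3 * p choose p) * (of_nat (2 * (p + k) choose (p + k)) / 16 ^ (p + k))
     / ((2 * of_nat k + 1) * fact (p - 2 * k - 1))"
    using assms p_eq by (subst wz_G_eq) auto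
  also have "\<dots> = 0 + of_nat p ^ 3 * z"
    unfolding 1 z_def e by (simp add: power2_eq_square power3_eq_cube ac_simps)
  finally show ?thesis unfolding rat_cong_ppow_iff using z by blast
qed

text \<open>For \<open>k = m\<close> the denominator \<open>2k + 1\<close> is \<open>p\<close>
  itself and cancels one of the two explicit factors. With one \<open>p\<close> left in front, the
  binomial coefficients are needed only modulo \<open>p^2\<close>.\<close>

lemma wz_G_m_cong: "p_cong (wz_G p m) (- 3 * of_nat p) 3"
proof -
  have e: "p - m - 1 = m" "2 * (p + m) = 3 * p - 1" "p - 2 * m - 1 = 0" using p_eq by simp_all
  have s: "(16 :: rat) ^ (p + m) = 4 ^ (3 * p - 1)" unfolding e(2)[symmetric] by (simp only: power_mult) simp
  have q: "2 * of_nat m + 1 = (of_nat p :: rat)" by (simp add: p_eq)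
  have "of_nat p \<noteq> (0 :: rat)" using p_eq by simp
  then have 1: "wz_G p m = of_nat p ^ 1 * (- 8 / 2 ^ (2 * (3 * p - 1)) * (of_nat (3 * p choose p) * ((-1) ^ m * of_nat (3 * p - 1 choose (p + m)))))"
    using p_eq by (subst wz_G_eq) (simp_all add: e s q pochhammer_half_nonzero power_mult power2_eq_square)
  have "p_cong (of_nat (3 * p choose p) * ((-1) ^ m * of_nat (3 * p - 1 choose (p + m)))) (3 * (2 * (1 - 3 * of_nat p * half_harmonic))) 2"
    using half_harmonic_integral by (intro rat_cong_ppow_mult binomial_3p_cong binomial_middle_cong p_integral_mult p_integral_diff) auto
  \<comment> \<open>The factor \<open>1 - 3ph\<close> also governs \<open>4^(3p-1)\<close>. Reading
    \<open>four_power_cong\<close> backwards replaces it by that power, which then cancels exactly,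
    so \<open>h\<close> disappears without inverting a congruence.\<close>
  also have "3 * (2 * (1 - 3 * of_nat p * half_harmonic)) = 3 / 2 ^ 3 * (16 * (1 - 3 * of_nat p * half_harmonic))" by simp
  also have "p_cong \<dots> (3 / 2 ^ 3 * 4 ^ (3 * p - 1)) 2"
    by (intro rat_cong_ppow_mult_left rat_cong_ppow_sym[OF four_power_cong] divide_two_power) auto
  finally have "p_cong (wz_G p m) (of_nat p ^ 1 * (- 8 / 2 ^ (2 * (3 * p - 1)) * (3 / 2 ^ 3 * 4 ^ (3 * p - 1)))) (1 + 2)"
    unfolding 1 by (intro rat_cong_ppow_mult_ppow rat_cong_ppow_mult_left divide_two_power p_integral_uminus) auto
  moreover have "of_nat p ^ 1 * (- 8 / 2 ^ (2 * (3 * p - 1)) * (3 / 2 ^ 3 * 4 ^ (3 * p - 1))) = (- 3 * of_nat p :: rat)"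
    by (simp add: power_mult)
  ultimately show ?thesis by (simp add: eval_nat_numeral)
qed

lemma wz_sum_cong: "p_cong (\<Sum>n<p. wz_F n 0) (3 * of_nat p) 3"
proof -
  have "(\<Sum>n<p. wz_F n 0) = (- 1) * ((\<Sum>k<m. wz_G p k) + wz_G p m)"
    using wz_sum[OF p_eq] by (simp add: lessThan_Suc_atMost[symmetric])
  also have "p_cong \<dots> ((- 1) * ((\<Sum>k<m. 0) + (- 3 * of_nat p))) 3"
    by (intro rat_cong_ppow_mult_left rat_cong_ppow_add rat_cong_ppow_sum wz_G_cong_0 wz_G_m_cong p_integral_uminus) auto
  finally show ?thesis by simp
qed

end

theorem theorem1p3:
  fixes p :: nat
  assumes "prime p" and "p > 2"
  shows "rat_cong_ppow
           (\<Sum>n = 0..p - 1. pochhammer (1/2 :: rat) n * pochhammer (1/3) n * pochhammer (2/3) n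
               / (pochhammer 1 n) ^ 3 * (11 * of_nat n + 3) * (27/16) ^ n)
           (3 * of_nat p) (int p) 3"
proof -
  have "odd p" using assms prime_odd_nat by blast
  then interpret odd_prime p "p div 2" using assms by unfold_locales auto
  have "{0..p - 1} = {..<p}" using assms by auto
  then show ?thesis using wz_sum_cong by (simp add: wz_F_zero_right)
qed

end
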